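(* Let $X$ be a finite dimensional Hilbert space over $\mathbb K\in\{\mathbb R,\mathbb C\}$ and let $\mathcal S=(S_n)_{n\in\mathbb Z}$ be a sequence of invertible linear operators on $X$ for which there is $C>0$ with $\|S_n\|,\|S_n^{-1}\|<C$ for all $n\in\mathbb Z$. Assume that $\mathcal S$ has an orthogonal basis $\mathcal E$. Then, for each $1\le p<+\infty$, the shift operator $\sigma_{\mathcal S}\colon\ell_p(X)\to\ell_p(X)$ is conjugate to the finite product of weighted backward shifts $$\prod_{x\in\mathcal E}B_{\omega(x)}\colon\big(\ell_p(\mathbb K)\big)^{\dim X}\to\big(\ell_p(\mathbb K)\big)^{\dim X}.$$
   Context: $\ell_p(Y)$ is the Banach space of bilateral sequences $(y_n)_{n\in\mathbb Z}$ in $Y$ with $\|(y_n)\|_p=(\sum_{n\in\mathbb Z}\|y_n\|^p)^{1/p}<\infty$; finite products of copies of $\ell_p(\mathbb K)$ carry the sum norm. Shift operator: $\sigma_{\mathcal S}((x_n)_{n\in\mathbb Z})=(S_{n+1}(x_{n+1}))_{n\in\mathbb Z}$. For a sequence $\omega=(\omega_n)_{n\in\mathbb Z}$ of scalars bounded and bounded away from $0$, the weighted backward shift is $B_\omega((t_n)_{n\in\mathbb Z})=(\omega_{n+1}t_{n+1})_{n\in\mathbb Z}$. For $n,m\in\mathbb Z$ let $S_{[n,m]}=S_n\circ S_{n+1}\circ\cdots\circ S_m$ if $n<m$, $S_{[n,n]}=S_n$, and $S_{[n,m]}=\mathrm{Id}$ if $n>m$. For $x\in X\setminus\{0\}$ define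 $\omega(x)=(\omega_n(x))_{n\in\mathbb Z}$ by $$\omega_n(x)=\frac{\|(S_{[1,n-1]})^{-1}(x)\|}{\|(S_{[1,n]})^{-1}(x)\|}\ (n>0),\qquad \omega_n(x)=\frac{\|S_{[n,0]}(x)\|}{\|S_{[n+1,0]}(x)\|}\ (n\le 0),$$ and the unit vectors $$e_n(x)=\frac{(S_{[1,n]})^{-1}(x)}{\|(S_{[1,n]})^{-1}(x)\|}\ (n\ge0),\qquad e_n(x)=\frac{S_{[n+1,0]}(x)}{\|S_{[n+1,0]}(x)\|}\ (n<0).$$ $\mathcal S$ has an orthogonal basis $\mathcal E$ if $\mathcal E$ is an (orthogonal) basis of $X$ such that, for every $n\in\mathbb Z$, the vectors $e_n(x)$, $x\in\mathcal E$, are pairwise orthogonal. Conjugate: bounded linear operators $T\colon Y\to Y$ and $R\colon Z\to Z$ on Banach spaces are conjugate if there is a bounded invertible linear operator (with bounded inverse) $H\colon Y\to Z$ with $H\circ T=R\circ H$. *)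

theory Defs
  imports "HOL-Analysis.Analysis"
begin

text \<open>
  The scalar fields \<open>\<real>\<close> and \<open>\<complex>\<close>, treated uniformly. The axioms force each element to satisfy
  a real quadratic equation, so these two fields are the only models up to isomorphism
  (lemma \<open>rc_field_real_or_complex\<close>), with \<open>kconj\<close> the usual conjugation.
\<close>

class rc_field = real_normed_field +
  fixes kconj :: "'a \<Rightarrow> 'a"
  assumes kconj_add: "kconj (x + y) = kconj x + kconj y"
    and add_kconj: "\<exists>r. x + kconj x = r *\<^sub>R 1"
    and mult_kconj: "x * kconj x = (norm x)\<^sup>2 *\<^sub>R 1"

instantiation real :: rc_field
begin
definition kconj_real :: "real \<Rightarrow> real" where "kconj_real x = x"
instance by standard (auto simp: kconj_real_def power2_eq_square)
end

instantiation complex :: rc_field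
begin
definition kconj_complex :: "complex \<Rightarrow> complex" where "kconj_complex = cnj"
instance
proof
  fix x y :: complex
  show "kconj (x + y) = kconj x + kconj y" by (simp add: kconj_complex_def)
  show "\<exists>r. x + kconj x = r *\<^sub>R 1"
    by (rule exI[of _ "2 * Re x"]) (simp add: kconj_complex_def complex_eq_iff)
  show "x * kconj x = (norm x)\<^sup>2 *\<^sub>R 1"
    by (simp add: kconj_complex_def complex_norm_square scaleR_conv_of_real flip: of_real_power)
qed
end

lemma rc_field_complete_square:
  fixes x :: "'k::rc_field"
  obtains a s :: real where "(x - of_real a)\<^sup>2 = of_real s"
proof -
  obtain r where r: "x + kconj x = of_real r"
    using add_kconj[of x] by (auto simp: scaleR_conv_of_real)
  define N where "N = (norm x)\<^sup>2"
  have m: "x * kconj x = of_real N"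
    using mult_kconj[of x] by (simp add: scaleR_conv_of_real N_def)
  have k: "kconj x = of_real r - x" using r by (simp add: algebra_simps)
  have e: "x * x = of_real r * x - of_real N"
    using m unfolding k by (simp add: algebra_simps)
  have "(x - of_real (r/2))\<^sup>2 = x * x - of_real r * x + of_real (r/2) * of_real (r/2)"
    by (simp add: power2_eq_square field_simps)
  also have "\<dots> = of_real ((r/2)*(r/2) - N)"
    by (simp add: e)
  finally show ?thesis by (rule that)
qed

lemma rc_field_real_or_complex:
  "(\<forall>x::'k::rc_field. x \<in> \<real>) \<or>
   (\<exists>i::'k. i * i = -1 \<and> (\<forall>x. \<exists>a b. x = of_real a + of_real b * i))"
proof (rule disjCI)
  have nonneg: "w \<in> \<real>" if "w\<^sup>2 = of_real s" "s \<ge> 0" for w :: 'k and s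
  proof -
    have "w\<^sup>2 = (of_real (sqrt s))\<^sup>2" using that by (simp flip: of_real_power)
    then have "w = of_real (sqrt s) \<or> w = - of_real (sqrt s)" by (simp add: power2_eq_iff)
    then show ?thesis by auto
  qed
  assume *: "\<not> (\<exists>i::'k. i * i = -1 \<and> (\<forall>x. \<exists>a b. x = of_real a + of_real b * i))"
  show "\<forall>x::'k. x \<in> \<real>"
  proof (rule ccontr)
    assume "\<not> (\<forall>x::'k. x \<in> \<real>)"
    then obtain x :: 'k where x: "x \<notin> \<real>" by blast
    obtain a s where as: "(x - of_real a)\<^sup>2 = of_real s" by (rule rc_field_complete_square)
    have "x - of_real a \<notin> \<real>"
    proof
      assume "x - of_real a \<in> \<real>"
      then have "(x - of_real a) + of_real a \<in> \<real>" by (intro Reals_add) auto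
      then show False using x by simp
    qed
    then have s: "s < 0" using nonneg[OF as] by force
    define i :: 'k where "i = (x - of_real a) / of_real (sqrt (-s))"
    have q: "(of_real (sqrt (-s)))\<^sup>2 = (of_real (-s) :: 'k)"
      using s by (simp flip: of_real_power)
    have i: "i\<^sup>2 = -1"
      using s unfolding i_def power_divide as q by simp
    have "\<exists>a b. z = of_real a + of_real b * i" for z
    proof -
      obtain c t where ct: "(z - of_real c)\<^sup>2 = of_real t" by (rule rc_field_complete_square)
      show ?thesis
      proof (cases "t \<ge> 0")
        case True
        then obtain d where "z - of_real c = of_real d" using nonneg[OF ct] by (auto elim: Reals_cases)
        then have "z = of_real (c + d) + of_real 0 * i" by (simp add: algebra_simps)
        then show ?thesis by blast
      next
        case False
        then have "(of_real (sqrt (-t)))\<^sup>2 = (of_real (-t) :: 'k)" by (simp flip: of_real_power)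
        then have "(z - of_real c)\<^sup>2 = (of_real (sqrt (-t)) * i)\<^sup>2"
          using ct i by (simp add: power_mult_distrib)
        then have "z - of_real c = of_real (sqrt (-t)) * i \<or> z - of_real c = - (of_real (sqrt (-t)) * i)"
          by (simp only: power2_eq_iff)
        then have "z = of_real c + of_real (sqrt (-t)) * i \<or> z = of_real c + of_real (- sqrt (-t)) * i"
          by (auto simp: algebra_simps)
        then show ?thesis by blast
      qed
    qed
    then show False using * i[unfolded power2_eq_square] by blast
  qed
qed

text \<open>
  A Hilbert space over \<open>'k\<close>: the norm is the library norm of the underlying real Banach space,
  required to be the one induced by the \<open>'k\<close>-valued inner product \<open>ip\<close>.
\<close>

locale hilbert_space = vector_space smul
  for smul :: "'k::rc_field \<Rightarrow> 'a::banach \<Rightarrow> 'a" +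
  fixes ip :: "'a \<Rightarrow> 'a \<Rightarrow> 'k"
  assumes scale_of_real: "smul (of_real r) x = r *\<^sub>R x"
    and ip_add_left: "ip (x + y) z = ip x z + ip y z"
    and ip_scale_left: "ip (smul c x) y = c * ip x y"
    and ip_commute: "ip y x = kconj (ip x y)"
    and ip_self: "ip x x = of_real ((norm x)\<^sup>2)"

locale finite_dim_hilbert_space = hilbert_space +
  assumes finite_dim: "\<exists>B. finite B \<and> span B = UNIV"

text \<open>
  Since \<open>p\<close> is a term variable, \<open>\<ell>\<^sub>p\<close> is a set of functions rather than a type; normed spaces over
  \<open>'k\<close> are therefore given by records with an explicit carrier.
\<close>

record ('k, 'v) nspace =
  nvecs :: "'v set"
  nadd :: "'v \<Rightarrow> 'v \<Rightarrow> 'v"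
  nscale :: "'k \<Rightarrow> 'v \<Rightarrow> 'v"
  nnorm :: "'v \<Rightarrow> real"

definition bounded_linear_between ::
  "('k, 'v) nspace \<Rightarrow> ('k, 'w) nspace \<Rightarrow> ('v \<Rightarrow> 'w) \<Rightarrow> bool" where
  "bounded_linear_between V W T \<longleftrightarrow>
     (\<forall>x\<in>nvecs V. T x \<in> nvecs W) \<and>
     (\<forall>x\<in>nvecs V. \<forall>y\<in>nvecs V. T (nadd V x y) = nadd W (T x) (T y)) \<and>
     (\<forall>c. \<forall>x\<in>nvecs V. T (nscale V c x) = nscale W c (T x)) \<and>
     (\<exists>M. \<forall>x\<in>nvecs V. nnorm W (T x) \<le> M * nnorm V x)"

definition conjugate_operators ::
  "('k, 'v) nspace \<Rightarrow> ('v \<Rightarrow> 'v) \<Rightarrow> ('k, 'w) nspace \<Rightarrow> ('w \<Rightarrow> 'w) \<Rightarrow> bool" where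
  "conjugate_operators V T W R \<longleftrightarrow>
     bounded_linear_between V V T \<and> bounded_linear_between W W R \<and>
     (\<exists>H. bounded_linear_between V W H \<and> bij_betw H (nvecs V) (nvecs W) \<and>
          bounded_linear_between W V (inv_into (nvecs V) H) \<and>
          (\<forall>x\<in>nvecs V. H (T x) = R (H x)))"

definition lp_space ::
  "real \<Rightarrow> ('k \<Rightarrow> 'a \<Rightarrow> 'a) \<Rightarrow> ('k, int \<Rightarrow> 'a::real_normed_vector) nspace" where
  "lp_space p smul =
     \<lparr> nvecs = {y. (\<lambda>n. norm (y n) powr p) summable_on UNIV},
       nadd = (\<lambda>y z n. y n + z n),
       nscale = (\<lambda>c y n. smul c (y n)),
       nnorm = (\<lambda>y. (\<Sum>\<^sub>\<infinity>n. norm (y n) powr p) powr (1 / p)) \<rparr>"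

text \<open>The product of copies of \<open>V\<close> indexed by a finite set \<open>I\<close>, with the sum norm.\<close>

definition power_space :: "'i set \<Rightarrow> ('k, 'v) nspace \<Rightarrow> ('k, 'i \<Rightarrow> 'v) nspace" where
  "power_space I V =
     \<lparr> nvecs = (\<Pi>\<^sub>E i\<in>I. nvecs V),
       nadd = (\<lambda>f g. \<lambda>i\<in>I. nadd V (f i) (g i)),
       nscale = (\<lambda>c f. \<lambda>i\<in>I. nscale V c (f i)),
       nnorm = (\<lambda>f. \<Sum>i\<in>I. nnorm V (f i)) \<rparr>"

definition product_operator :: "'i set \<Rightarrow> ('i \<Rightarrow> 'v \<Rightarrow> 'v) \<Rightarrow> ('i \<Rightarrow> 'v) \<Rightarrow> ('i \<Rightarrow> 'v)" where
  "product_operator I T f = (\<lambda>i\<in>I. T i (f i))"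

definition shift_operator :: "(int \<Rightarrow> 'a \<Rightarrow> 'a) \<Rightarrow> (int \<Rightarrow> 'a) \<Rightarrow> (int \<Rightarrow> 'a)" where
  "shift_operator S x = (\<lambda>n. S (n + 1) (x (n + 1)))"

definition weighted_backward_shift :: "(int \<Rightarrow> 'k::times) \<Rightarrow> (int \<Rightarrow> 'k) \<Rightarrow> (int \<Rightarrow> 'k)" where
  "weighted_backward_shift w t = (\<lambda>n. w (n + 1) * t (n + 1))"

text \<open>\<open>S n \<circ> S (n + 1) \<circ> \<dots> \<circ> S m\<close>; the list \<open>[n..m]\<close> is empty for \<open>n > m\<close>, giving \<open>id\<close>.\<close>

definition block :: "(int \<Rightarrow> 'a \<Rightarrow> 'a) \<Rightarrow> int \<Rightarrow> int \<Rightarrow> 'a \<Rightarrow> 'a" where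
  "block S n m = foldr (\<circ>) (map S [n..m]) id"

definition orbit_weight :: "(int \<Rightarrow> 'a \<Rightarrow> 'a) \<Rightarrow> 'a::real_normed_vector \<Rightarrow> int \<Rightarrow> real" where
  "orbit_weight S x n =
     (if n > 0 then norm (inv (block S 1 (n - 1)) x) / norm (inv (block S 1 n) x)
      else norm (block S n 0 x) / norm (block S (n + 1) 0 x))"

definition orbit_vector :: "(int \<Rightarrow> 'a \<Rightarrow> 'a) \<Rightarrow> 'a::real_normed_vector \<Rightarrow> int \<Rightarrow> 'a" where
  "orbit_vector S x n =
     (if n \<ge> 0 then inv (block S 1 n) x /\<^sub>R norm (inv (block S 1 n) x)
      else block S (n + 1) 0 x /\<^sub>R norm (block S (n + 1) 0 x))"

definition (in hilbert_space) has_orthogonal_basis :: "(int \<Rightarrow> 'a \<Rightarrow> 'a) \<Rightarrow> 'a set \<Rightarrow> bool" where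
  "has_orthogonal_basis S E \<longleftrightarrow>
     independent E \<and> span E = UNIV \<and> pairwise (\<lambda>x y. ip x y = 0) E \<and>
     (\<forall>n. pairwise (\<lambda>x y. ip (orbit_vector S x n) (orbit_vector S y n) = 0) E)"

end

theory Submission
  imports Defs
begin

text \<open>
  Each vector \<open>x\<close> of the basis lies on exactly one bilateral orbit \<open>v\<close> of the system, that is,
  \<open>S (n + 1) (v (n + 1)) = v n\<close> for all \<open>n\<close> and \<open>v 0 = x\<close> (\<open>orbit_point_step\<close>), and
  \<open>orbit_vector S x n\<close> is \<open>v n\<close> normalised. Hence \<open>S (n + 1)\<close> sends the unit vector at time \<open>n + 1\<close>
  to a multiple of the unit vector at time \<open>n\<close>, the factor being the ratio of the norms of \<open>v n\<close>
  and \<open>v (n + 1)\<close>, which is \<open>orbit_weight S x (n + 1)\<close> (\<open>orbit_vector_step\<close>). So along each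
  orbit the shift operator acts as a weighted backward shift.

  For fixed \<open>n\<close> the point \<open>v n\<close> depends on \<open>x\<close> through a linear bijection, which carries the basis
  \<open>E\<close> to a basis; since the orbits stay orthogonal, the unit vectors at time \<open>n\<close> form an
  orthonormal basis (\<open>orbit_expansion\<close>). The conjugacy takes a sequence \<open>y\<close> to the coordinates of
  each \<open>y n\<close> in the orthonormal basis at time \<open>n\<close>. Orthonormality makes this change of coordinates
  bounded in both directions uniformly in \<open>n\<close>: each coordinate is at most \<open>norm (y n)\<close>
  (\<open>norm_ip_unit_le\<close>), and \<open>norm (y n)\<close> is at most the sum of the absolute values of the
  coordinates. Such pointwise estimates with finitely many terms pass to \<open>\<ell>\<^sub>p\<close> norms by
  \<open>lp_dominated\<close>.
\<close>

section \<open>Pointwise domination in sequence spaces\<close>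

definition lp_summable :: "real \<Rightarrow> (int \<Rightarrow> 'b::real_normed_vector) \<Rightarrow> bool" where
  "lp_summable p y \<longleftrightarrow> (\<lambda>n. norm (y n) powr p) summable_on UNIV"

definition lp_norm :: "real \<Rightarrow> (int \<Rightarrow> 'b::real_normed_vector) \<Rightarrow> real" where
  "lp_norm p y = (\<Sum>\<^sub>\<infinity>n. norm (y n) powr p) powr (1 / p)"

lemma lp_space_simps:
  "nvecs (lp_space p s) = {y. lp_summable p y}"
  "nadd (lp_space p s) = (\<lambda>y z n. y n + z n)"
  "nscale (lp_space p s) = (\<lambda>c y n. s c (y n))"
  "nnorm (lp_space p s) = lp_norm p"
  by (auto simp: lp_space_def lp_summable_def lp_norm_def)

lemma power_space_simps:
  "nvecs (power_space I V) = (\<Pi>\<^sub>E i\<in>I. nvecs V)"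
  "nadd (power_space I V) = (\<lambda>f g. \<lambda>i\<in>I. nadd V (f i) (g i))"
  "nscale (power_space I V) = (\<lambda>c f. \<lambda>i\<in>I. nscale V c (f i))"
  "nnorm (power_space I V) = (\<lambda>f. \<Sum>i\<in>I. nnorm V (f i))"
  by (auto simp: power_space_def)

lemma lp_norm_nonneg: "lp_norm p y \<ge> 0"
  by (simp add: lp_norm_def)

text \<open>A crude substitute for the power mean inequality: the sum is at most \<open>card I\<close> times its
  largest term.\<close>

lemma sum_powr_le:
  fixes a :: "'i \<Rightarrow> real"
  assumes "finite I" "\<And>i. i \<in> I \<Longrightarrow> a i \<ge> 0" "p > 0"
  shows "(\<Sum>i\<in>I. a i) powr p \<le> real (card I) powr p * (\<Sum>i\<in>I. a i powr p)"
proof (cases "I = {}")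
  case False
  have "Max (a ` I) \<in> a ` I"
    using assms(1) False by (intro Max_in) auto
  then obtain j where j: "j \<in> I" "Max (a ` I) = a j"
    by (rule imageE)
  have le: "a i \<le> a j" if "i \<in> I" for i
    using that assms(1) unfolding j(2)[symmetric] by simp
  have "(\<Sum>i\<in>I. a i) \<le> real (card I) * a j"
    using sum_bounded_above[of I a "a j"] le by simp
  then have "(\<Sum>i\<in>I. a i) powr p \<le> (real (card I) * a j) powr p"
    using assms by (intro powr_mono2 sum_nonneg) auto
  also have "\<dots> = real (card I) powr p * a j powr p"
    using assms j by (simp add: powr_mult)
  also have "\<dots> \<le> real (card I) powr p * (\<Sum>i\<in>I. a i powr p)"
    using assms(1) j by (intro mult_left_mono member_le_sum) auto
  finally show ?thesis .
qed auto

text \<open>Every boundedness claim about \<open>\<ell>\<^sub>p\<close> below, including closure under addition and scaling, is an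
  instance of this lemma, so that Minkowski's inequality is avoided; the constant does not
  matter, only that it depends on neither the sequences \<open>f i\<close> nor \<open>z\<close>.\<close>

lemma lp_dominated:
  fixes f :: "'i \<Rightarrow> int \<Rightarrow> 'b::real_normed_vector" and z :: "int \<Rightarrow> 'c::real_normed_vector"
    and c :: real
  assumes I: "finite I" and p: "p > 0" and c: "c \<ge> 0"
    and f: "\<And>i. i \<in> I \<Longrightarrow> lp_summable p (f i)"
    and z: "\<And>n. norm (z n) \<le> c * (\<Sum>i\<in>I. norm (f i n))"
  shows "lp_summable p z"
    and "lp_norm p z \<le> c * card I * card I powr (1 / p) * (\<Sum>i\<in>I. lp_norm p (f i))"
proof -
  define A where "A i = (\<Sum>\<^sub>\<infinity>n. norm (f i n) powr p)" for i
  define M where "M = (\<Sum>i\<in>I. lp_norm p (f i))"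
  have M0: "M \<ge> 0" by (simp add: M_def sum_nonneg lp_norm_nonneg)
  let ?K = "(c * card I) powr p"
  let ?g = "\<lambda>n. ?K * (\<Sum>i\<in>I. norm (f i n) powr p)"
  have le: "norm (z n) powr p \<le> ?g n" for n
  proof -
    have "norm (z n) powr p \<le> (c * (\<Sum>i\<in>I. norm (f i n))) powr p"
      using z[of n] p by (intro powr_mono2) auto
    also have "\<dots> = c powr p * (\<Sum>i\<in>I. norm (f i n)) powr p"
      using c by (simp add: powr_mult sum_nonneg)
    also have "\<dots> \<le> c powr p * (card I powr p * (\<Sum>i\<in>I. norm (f i n) powr p))"
      using I p by (intro mult_left_mono sum_powr_le) auto
    finally show ?thesis using c by (simp add: powr_mult mult.assoc)
  qed
  have hs: "((\<lambda>n. \<Sum>i\<in>I. norm (f i n) powr p) has_sum (\<Sum>i\<in>I. A i)) UNIV"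
    using I f
  proof (induction I rule: finite_induct)
    case (insert i I)
    have "((\<lambda>n. norm (f i n) powr p) has_sum A i) UNIV"
      unfolding A_def using insert.prems by (intro has_sum_infsum) (auto simp: lp_summable_def)
    then show ?case
      using insert by (auto intro: has_sum_add)
  qed auto
  have hg: "(?g has_sum (?K * (\<Sum>i\<in>I. A i))) UNIV"
    by (rule has_sum_cmult_right[OF hs])
  have sz: "(\<lambda>n. norm (z n) powr p) summable_on UNIV"
    by (rule summable_on_comparison_test[of ?g]) (use hg le in \<open>auto simp: summable_on_def\<close>)
  then show "lp_summable p z" by (simp add: lp_summable_def)
  have A: "A i \<le> M powr p" if "i \<in> I" for i
  proof -
    have A0: "A i \<ge> 0" unfolding A_def by (intro infsum_nonneg) auto
    have "lp_norm p (f i) \<le> M"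
      unfolding M_def using that I by (intro member_le_sum) (auto simp: lp_norm_nonneg)
    then have "(A i powr (1 / p)) powr p \<le> M powr p"
      using p by (intro powr_mono2) (auto simp: lp_norm_def A_def)
    then show ?thesis using A0 p by (simp add: powr_powr)
  qed
  have "(\<Sum>\<^sub>\<infinity>n. norm (z n) powr p) \<le> ?K * (\<Sum>i\<in>I. A i)"
    by (rule has_sum_mono[OF has_sum_infsum[OF sz] hg]) (use le in auto)
  also have "\<dots> \<le> ?K * (card I * M powr p)"
    using sum_bounded_above[of I A "M powr p"] A by (intro mult_left_mono) auto
  finally have "(\<Sum>\<^sub>\<infinity>n. norm (z n) powr p) powr (1 / p) \<le> (?K * (card I * M powr p)) powr (1 / p)"
    using p by (intro powr_mono2 infsum_nonneg) auto
  also have "\<dots> = c * card I * card I powr (1 / p) * M"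
    using c p M0 by (simp add: powr_mult powr_powr)
  finally show "lp_norm p z \<le> c * card I * card I powr (1 / p) * (\<Sum>i\<in>I. lp_norm p (f i))"
    by (simp add: lp_norm_def M_def)
qed

lemma lp_dominated_single:
  assumes "p > 0" "c \<ge> 0" "lp_summable p y" "\<And>n. norm (z n) \<le> c * norm (y n)"
  shows "lp_summable p z" "lp_norm p z \<le> c * lp_norm p y"
  using lp_dominated[of "{()}" p c "\<lambda>_. y" z] assms by auto

lemma lp_summable_add:
  fixes y z :: "int \<Rightarrow> 'b::real_normed_vector"
  assumes "p > 0" "lp_summable p y" "lp_summable p z"
  shows "lp_summable p (\<lambda>n. y n + z n)"
proof (rule lp_dominated(1)[of "UNIV :: bool set" p 1 "\<lambda>b. if b then y else z"])
  show "norm (y n + z n) \<le> 1 * (\<Sum>b\<in>UNIV. norm ((if b then y else z) n))" for n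
    using norm_triangle_ineq[of "y n" "z n"] by (simp add: UNIV_bool)
qed (use assms in auto)

lemma lp_translate:
  shows "lp_summable p (\<lambda>n. y (n + 1)) \<longleftrightarrow> lp_summable p y"
    and "lp_norm p (\<lambda>n. y (n + 1)) = lp_norm p y"
proof -
  have b: "bij_betw (\<lambda>n::int. n + 1) UNIV UNIV"
    by (rule bij_betwI[of _ _ _ "\<lambda>n. n - 1"]) auto
  show "lp_summable p (\<lambda>n. y (n + 1)) \<longleftrightarrow> lp_summable p y"
    using summable_on_reindex_bij_betw[OF b, of "\<lambda>n. norm (y n) powr p"]
    by (simp add: lp_summable_def)
  show "lp_norm p (\<lambda>n. y (n + 1)) = lp_norm p y"
    using infsum_reindex_bij_betw[OF b, of "\<lambda>n. norm (y n) powr p"]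
    by (simp add: lp_norm_def)
qed

section \<open>A criterion for conjugacy\<close>

section \<open>A criterion for conjugacy\<close>

lemma bounded_linear_between_compose:
  assumes F: "bounded_linear_between U V F" and G: "bounded_linear_between V W G"
    and nonneg: "\<And>y. y \<in> nvecs V \<Longrightarrow> nnorm V y \<ge> 0"
  shows "bounded_linear_between U W (\<lambda>x. G (F x))"
proof -
  obtain M where M: "\<forall>x\<in>nvecs U. nnorm V (F x) \<le> M * nnorm U x"
    using F by (auto simp: bounded_linear_between_def)
  obtain N where N: "\<forall>y\<in>nvecs V. nnorm W (G y) \<le> N * nnorm V y"
    using G by (auto simp: bounded_linear_between_def)
  have FV: "F x \<in> nvecs V" if "x \<in> nvecs U" for x
    using F that by (auto simp: bounded_linear_between_def)
  have "nnorm W (G (F x)) \<le> (\<bar>N\<bar> * M) * nnorm U x" if x: "x \<in> nvecs U" for x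
  proof -
    have "nnorm W (G (F x)) \<le> N * nnorm V (F x)"
      using N FV[OF x] by auto
    also have "\<dots> \<le> \<bar>N\<bar> * nnorm V (F x)"
      using nonneg[OF FV[OF x]] by (intro mult_right_mono) auto
    also have "\<dots> \<le> \<bar>N\<bar> * (M * nnorm U x)"
      using M x by (intro mult_left_mono) auto
    finally show ?thesis by (simp add: mult.assoc)
  qed
  then show ?thesis
    using F G unfolding bounded_linear_between_def by auto
qed

text \<open>Since \<open>F'\<close> agrees with \<open>F\<close> on the carrier alone, the sums and multiples that occur in the
  linearity of \<open>F'\<close> must stay in the carrier.\<close>

lemma bounded_linear_between_cong:
  assumes F: "bounded_linear_between V W F" and eq: "\<And>x. x \<in> nvecs V \<Longrightarrow> F' x = F x"
    and add: "\<And>x y. x \<in> nvecs V \<Longrightarrow> y \<in> nvecs V \<Longrightarrow> nadd V x y \<in> nvecs V"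
    and scale: "\<And>c x. x \<in> nvecs V \<Longrightarrow> nscale V c x \<in> nvecs V"
  shows "bounded_linear_between V W F'"
  using F by (simp add: bounded_linear_between_def eq add scale)

text \<open>The operator on \<open>W\<close> is obtained by transporting \<open>T\<close>, and so inherits boundedness from \<open>T\<close>,
  \<open>H\<close> and \<open>G\<close>. For the shift, this replaces an estimate of the weights.\<close>

lemma conjugate_operatorsI:
  assumes T: "bounded_linear_between V V T"
    and H: "bounded_linear_between V W H" and G: "bounded_linear_between W V G"
    and GH: "\<And>x. x \<in> nvecs V \<Longrightarrow> G (H x) = x"
    and HG: "\<And>f. f \<in> nvecs W \<Longrightarrow> H (G f) = f"
    and R: "\<And>f. f \<in> nvecs W \<Longrightarrow> R f = H (T (G f))"
    and nonneg: "\<And>x. x \<in> nvecs V \<Longrightarrow> nnorm V x \<ge> 0"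
    and add: "\<And>f g. f \<in> nvecs W \<Longrightarrow> g \<in> nvecs W \<Longrightarrow> nadd W f g \<in> nvecs W"
    and scale: "\<And>c f. f \<in> nvecs W \<Longrightarrow> nscale W c f \<in> nvecs W"
  shows "conjugate_operators V T W R"
proof -
  have HW: "H x \<in> nvecs W" if "x \<in> nvecs V" for x
    using H that by (auto simp: bounded_linear_between_def)
  have GV: "G f \<in> nvecs V" if "f \<in> nvecs W" for f
    using G that by (auto simp: bounded_linear_between_def)
  have bij: "bij_betw H (nvecs V) (nvecs W)"
    by (rule bij_betwI[of _ _ _ G]) (auto simp: HW GV GH HG)
  have "inv_into (nvecs V) H f = G f" if "f \<in> nvecs W" for f
    using inv_into_f_f[OF bij_betw_imp_inj_on[OF bij] GV[OF that]] HG[OF that] by simp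
  then have inv: "bounded_linear_between W V (inv_into (nvecs V) H)"
    by (rule bounded_linear_between_cong[OF G _ add scale])
  have "bounded_linear_between W W (\<lambda>f. H (T (G f)))"
    by (intro bounded_linear_between_compose[OF _ H] bounded_linear_between_compose[OF G T] nonneg)
  then have "bounded_linear_between W W R"
    by (rule bounded_linear_between_cong[OF _ R add scale])
  then show ?thesis
    unfolding conjugate_operators_def using T H bij inv HW R GH by (intro conjI exI[of _ H]) auto
qed

section \<open>Orthonormal expansions\<close>

lemma kconj_zero [simp]: "kconj (0::'k::rc_field) = 0"
  using kconj_add[of "0::'k" 0] by simp

text \<open>Multiplicativity of \<open>kconj\<close> is not among its axioms. For real factors it follows from
  \<open>mult_kconj\<close> by cancelling \<open>c * of_real r\<close>.\<close>

lemma kconj_mult_of_real: "kconj (c * of_real r) = kconj c * (of_real r :: 'k::rc_field)"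
proof (cases "c * of_real r = 0")
  case False
  have "(c * of_real r) * kconj (c * of_real r) = (c * of_real r) * (kconj c * of_real r)"
  proof -
    have "(c * of_real r) * kconj (c * of_real r) = of_real ((norm c)\<^sup>2 * r\<^sup>2)"
      by (simp only: mult_kconj scaleR_conv_of_real mult_1_right norm_mult norm_of_real
          power_mult_distrib power2_abs)
    also have "\<dots> = (c * kconj c) * (of_real r * of_real r)"
      by (simp add: mult_kconj scaleR_conv_of_real power2_eq_square)
    finally show ?thesis by (simp only: mult_ac)
  qed
  then show ?thesis using False by simp
qed auto

context hilbert_space
begin

lemma ip_zero_left [simp]: "ip 0 y = 0"
  using ip_add_left[of 0 0 y] by simp

lemma ip_sum_left: "ip (\<Sum>i\<in>I. f i) y = (\<Sum>i\<in>I. ip (f i) y)"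
  by (induction I rule: infinite_finite_induct) (auto simp: ip_add_left)

lemma ip_add_right: "ip x (y + z) = ip x y + ip x z"
proof -
  have "ip x (y + z) = kconj (ip y x + ip z x)"
    by (simp only: ip_commute[of x "y + z"] ip_add_left)
  also have "\<dots> = ip x y + ip x z"
    by (simp only: kconj_add ip_commute[of x y] ip_commute[of x z])
  finally show ?thesis .
qed

lemma ip_zero_commute: "ip x y = 0 \<Longrightarrow> ip y x = 0"
  by (subst ip_commute) simp

lemma norm_smul: "norm (smul c x) = norm c * norm x"
proof -
  have "ip x (smul c x) = kconj (ip (smul c x) x)"
    by (rule ip_commute)
  also have "\<dots> = kconj c * of_real ((norm x)\<^sup>2)"
    by (simp only: ip_scale_left ip_self kconj_mult_of_real)
  finally have "ip (smul c x) (smul c x) = (c * kconj c) * of_real ((norm x)\<^sup>2)"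
    by (simp add: ip_scale_left)
  also have "\<dots> = of_real ((norm c * norm x)\<^sup>2)"
    by (simp add: mult_kconj scaleR_conv_of_real power_mult_distrib)
  finally have "(norm (smul c x))\<^sup>2 = (norm c * norm x)\<^sup>2"
    unfolding ip_self by (simp only: of_real_eq_iff)
  then show ?thesis by simp
qed

text \<open>Split \<open>x\<close> into its component along \<open>e\<close> and an orthogonal remainder, and apply Pythagoras.\<close>

lemma norm_ip_unit_le:
  assumes "norm e = 1"
  shows "norm (ip x e) \<le> norm x"
proof -
  define u where "u = smul (ip x e) e"
  define w where "w = x - u"
  have x: "x = u + w" by (simp add: w_def)
  have "ip u e = ip x e" by (simp add: u_def ip_scale_left ip_self assms)
  moreover have "ip x e = ip u e + ip w e" by (subst x) (simp add: ip_add_left)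
  ultimately have "ip w e = 0" by simp
  then have uw: "ip u w = 0" by (simp add: u_def ip_scale_left ip_zero_commute)
  have "ip x x = ip u u + ip w w"
    by (simp add: x ip_add_left ip_add_right uw ip_zero_commute)
  then have "(norm x)\<^sup>2 = (norm u)\<^sup>2 + (norm w)\<^sup>2"
    unfolding ip_self by (simp only: of_real_add[symmetric] of_real_eq_iff)
  then have "(norm u)\<^sup>2 \<le> (norm x)\<^sup>2" by simp
  then have "norm u \<le> norm x" by (rule power2_le_imp_le) simp
  then show ?thesis by (simp add: u_def norm_smul assms)
qed

lemma ip_orthonormal_sum:
  assumes "finite I" and "\<And>i. i \<in> I \<Longrightarrow> norm (e i) = 1"
    and "pairwise (\<lambda>i j. ip (e i) (e j) = 0) I" and "j \<in> I"
  shows "ip (\<Sum>i\<in>I. smul (c i) (e i)) (e j) = c j"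
proof -
  have "ip (smul (c i) (e i)) (e j) = (if i = j then c j else 0)" if "i \<in> I" for i
    using assms that by (auto simp: ip_scale_left ip_self pairwise_def)
  then have "ip (\<Sum>i\<in>I. smul (c i) (e i)) (e j) = (\<Sum>i\<in>I. if i = j then c j else 0)"
    unfolding ip_sum_left by (intro sum.cong) auto
  also have "\<dots> = c j"
    using assms by simp
  finally show ?thesis .
qed

lemma norm_sum_unit_le:
  assumes "\<And>i. i \<in> I \<Longrightarrow> norm (e i) = 1"
  shows "norm (\<Sum>i\<in>I. smul (c i) (e i)) \<le> (\<Sum>i\<in>I. norm (c i))"
  by (rule sum_norm_le) (simp add: norm_smul assms)

text \<open>Linearity over the scalars does not include continuity, without which \<open>onorm\<close> says nothing
  about \<open>T\<close>. It holds because \<open>T x\<close> combines the finitely many vectors \<open>T (e i)\<close> with coefficients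
  of modulus at most \<open>norm x\<close>.\<close>

lemma linear_imp_bounded_linear:
  assumes T: "Vector_Spaces.linear smul smul T"
    and I: "finite I" "\<And>i. i \<in> I \<Longrightarrow> norm (e i) = 1"
    and expand: "\<And>x. x = (\<Sum>i\<in>I. smul (ip x (e i)) (e i))"
  shows "bounded_linear T"
proof
  interpret T: Vector_Spaces.linear smul smul T by (rule T)
  show "T (x + y) = T x + T y" for x y by (rule T.add)
  show "T (r *\<^sub>R x) = r *\<^sub>R T x" for r x
    using T.scale[of "of_real r" x] by (simp add: scale_of_real)
  have "norm (T x) \<le> norm x * (\<Sum>i\<in>I. norm (T (e i)))" for x
  proof -
    have "T x = (\<Sum>i\<in>I. smul (ip x (e i)) (T (e i)))"
      by (subst expand[of x]) (simp add: T.sum T.scale)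
    also have "norm \<dots> \<le> (\<Sum>i\<in>I. norm x * norm (T (e i)))"
      by (rule sum_norm_le) (use I norm_ip_unit_le in \<open>auto simp: norm_smul intro!: mult_right_mono\<close>)
    finally show ?thesis by (simp add: sum_distrib_left)
  qed
  then show "\<exists>K. \<forall>x. norm (T x) \<le> norm x * K" by blast
qed

end

section \<open>Orbits of the system\<close>

lemma block_empty: "n > m \<Longrightarrow> block S n m = id"
  by (simp add: block_def)

lemma block_rec1: "n \<le> m \<Longrightarrow> block S n m = S n \<circ> block S (n + 1) m"
  by (simp add: block_def upto_rec1[of n m])

lemma block_rec2:
  assumes "n \<le> m"
  shows "block S n m = block S n (m - 1) \<circ> S m"
proof -
  have snoc: "foldr (\<circ>) (fs @ [f]) id = foldr (\<circ>) fs id \<circ> f" for fs and f :: "'a \<Rightarrow> 'a"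
    by (induction fs) (simp_all add: comp_assoc)
  show ?thesis
    by (simp only: block_def upto_rec2[OF assms] map_append list.map snoc)
qed

text \<open>The linear map taking a vector to the point at time \<open>n\<close> of the orbit that passes through it at
  time \<open>0\<close>.\<close>

definition orbit_point :: "(int \<Rightarrow> 'a \<Rightarrow> 'a) \<Rightarrow> int \<Rightarrow> 'a \<Rightarrow> 'a" where
  "orbit_point S n = (if n \<ge> 0 then inv (block S 1 n) else block S (n + 1) 0)"

text \<open>At \<open>n = 0\<close> both branches are the identity, which is why the formulas for positive and for
  nonpositive times fit together to a single orbit.\<close>

lemma orbit_point_nonpos: "n \<le> 0 \<Longrightarrow> orbit_point S n = block S (n + 1) 0"
  by (cases "n = 0") (auto simp: orbit_point_def block_empty)

lemma orbit_vector_eq: "orbit_vector S x n = orbit_point S n x /\<^sub>R norm (orbit_point S n x)"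
  by (simp add: orbit_vector_def orbit_point_def)

lemma orbit_weight_eq:
  "orbit_weight S x n = norm (orbit_point S (n - 1) x) / norm (orbit_point S n x)"
proof (cases "n > 0")
  case True
  then show ?thesis by (simp add: orbit_weight_def orbit_point_def)
next
  case False
  then show ?thesis by (simp add: orbit_weight_def orbit_point_nonpos)
qed

lemma bij_block:
  assumes "\<And>n. bij (S n)"
  shows "bij (block S n m)"
proof -
  have "bij (foldr (\<circ>) (map S ns) id)" for ns
    using assms by (induction ns) (auto intro: bij_comp)
  then show ?thesis by (simp add: block_def)
qed

lemma bij_orbit_point:
  assumes "\<And>n. bij (S n)"
  shows "bij (orbit_point S n)"
  using assms by (simp add: orbit_point_def bij_block bij_imp_bij_inv)

lemma orbit_point_step:
  assumes bij: "\<And>n. bij (S n)"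
  shows "S (n + 1) (orbit_point S (n + 1) x) = orbit_point S n x"
proof (cases "n \<ge> 0")
  case True
  let ?A = "block S 1 n" and ?B = "block S 1 (n + 1)"
  have "?A (S (n + 1) (inv ?B x)) = ?B (inv ?B x)"
    using True by (simp add: block_rec2[of 1 "n + 1"])
  also have "\<dots> = x"
    by (simp add: bij_block[of S, OF bij] bij_is_surj surj_f_inv_f)
  finally have "S (n + 1) (inv ?B x) = inv ?A x"
    by (rule inv_f_eq[OF bij_is_inj[OF bij_block[of S, OF bij]], symmetric])
  then show ?thesis using True by (simp add: orbit_point_def)
next
  case False
  then show ?thesis
    by (simp add: orbit_point_nonpos block_rec1[of "n + 1" 0])
qed

context hilbert_space
begin

lemma linear_inv:
  assumes f: "Vector_Spaces.linear smul smul f" "bij f"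
  shows "Vector_Spaces.linear smul smul (inv f)"
proof -
  interpret f: Vector_Spaces.linear smul smul f by (rule f)
  have r: "f (inv f x) = x" for x
    using f(2) by (simp add: bij_is_surj surj_f_inv_f)
  have "inv f (x + y) = inv f x + inv f y" "inv f (smul c x) = smul c (inv f x)" for x y c
    by (rule inv_f_eq[OF bij_is_inj[OF f(2)]]; simp add: f.add f.scale r)+
  then show ?thesis
    using vector_space_axioms by (simp add: Vector_Spaces.linear_iff)
qed

lemma basis_nonzero:
  assumes "has_orthogonal_basis S E" "x \<in> E"
  shows "x \<noteq> 0"
  using assms dependent_zero by (auto simp: has_orthogonal_basis_def)

end

locale invertible_system = hilbert_space smul ip
  for smul :: "'k::rc_field \<Rightarrow> 'a::banach \<Rightarrow> 'a" and ip +
  fixes S :: "int \<Rightarrow> 'a \<Rightarrow> 'a"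
  assumes linear_S: "Vector_Spaces.linear smul smul (S n)" and bij_S: "bij (S n)"
begin

lemma linear_block: "Vector_Spaces.linear smul smul (block S n m)"
proof -
  have "Vector_Spaces.linear smul smul (foldr (\<circ>) (map S ns) id)" for ns
    using linear_S vector_space_axioms by (induction ns) (auto simp: Vector_Spaces.linear_iff)
  then show ?thesis by (simp add: block_def)
qed

lemma linear_orbit_point: "Vector_Spaces.linear smul smul (orbit_point S n)"
  using bij_S by (simp add: orbit_point_def linear_block linear_inv bij_block)

lemma norm_orbit_point_pos:
  assumes "x \<noteq> 0"
  shows "norm (orbit_point S n x) > 0"
proof -
  interpret A: Vector_Spaces.linear smul smul "orbit_point S n"
    by (rule linear_orbit_point)
  have "orbit_point S n x \<noteq> orbit_point S n 0"
    using bij_is_inj[OF bij_orbit_point[of S, OF bij_S]] assms by (simp only: inj_eq not_False_eq_True)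
  then show ?thesis by (simp add: A.zero)
qed

lemma norm_orbit_vector:
  assumes "x \<noteq> 0"
  shows "norm (orbit_vector S x n) = 1"
  using norm_orbit_point_pos[OF assms, of n] by (simp add: orbit_vector_eq)

lemma orbit_vector_step:
  assumes "x \<noteq> 0"
  shows "S (n + 1) (orbit_vector S x (n + 1))
    = smul (of_real (orbit_weight S x (n + 1))) (orbit_vector S x n)"
proof -
  interpret A: Vector_Spaces.linear smul smul "S (n + 1)" by (rule linear_S)
  have scaleR: "S (n + 1) (r *\<^sub>R y) = r *\<^sub>R S (n + 1) y" for r y
    using A.scale[of "of_real r" y] by (simp add: scale_of_real)
  have "S (n + 1) (orbit_vector S x (n + 1)) = orbit_weight S x (n + 1) *\<^sub>R orbit_vector S x n"
    using norm_orbit_point_pos[OF assms, of n]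
    by (simp add: orbit_vector_eq orbit_weight_eq scaleR orbit_point_step[of S, OF bij_S]
        divide_inverse)
  then show ?thesis by (simp only: scale_of_real)
qed

end

locale orthogonal_system = invertible_system smul ip S
  for smul :: "'k::rc_field \<Rightarrow> 'a::banach \<Rightarrow> 'a" and ip S +
  fixes E :: "'a set"
  assumes basis: "has_orthogonal_basis S E" and finite_basis: "finite E"
begin

lemma norm_orbit_vector_basis: "x \<in> E \<Longrightarrow> norm (orbit_vector S x n) = 1"
  using norm_orbit_vector basis_nonzero[OF basis] by blast

lemma ip_orbit_sum:
  assumes "x \<in> E"
  shows "ip (\<Sum>z\<in>E. smul (c z) (orbit_vector S z n)) (orbit_vector S x n) = c x"
  by (rule ip_orthonormal_sum)
     (use basis finite_basis norm_orbit_vector_basis assms in \<open>auto simp: has_orthogonal_basis_def\<close>)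

text \<open>The expansion in \<open>E\<close> of the preimage of \<open>y\<close> under the bijection \<open>orbit_point S n\<close> is mapped to
  an expansion of \<open>y\<close> in the orbit vectors at time \<open>n\<close>; their orthonormality identifies the
  coefficients.\<close>

lemma orbit_expansion:
  "y = (\<Sum>x\<in>E. smul (ip y (orbit_vector S x n)) (orbit_vector S x n))"
proof -
  let ?A = "orbit_point S n" and ?e = "\<lambda>x. orbit_vector S x n"
  interpret A: Vector_Spaces.linear smul smul ?A
    by (rule linear_orbit_point)
  have "inv ?A y \<in> span E"
    using basis by (simp add: has_orthogonal_basis_def)
  then obtain u where u: "inv ?A y = (\<Sum>x\<in>E. smul (u x) x)"
    using span_finite[OF finite_basis] by auto
  have "y = ?A (inv ?A y)"
    using bij_orbit_point[of S, OF bij_S] by (simp add: bij_is_surj surj_f_inv_f)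
  also have "\<dots> = (\<Sum>x\<in>E. smul (u x) (?A x))"
    by (simp add: u A.sum A.scale)
  also have "\<dots> = (\<Sum>x\<in>E. smul (u x * of_real (norm (?A x))) (?e x))"
  proof (rule sum.cong)
    fix x assume "x \<in> E"
    then have "norm (?A x) > 0"
      using norm_orbit_point_pos basis_nonzero[OF basis] by blast
    then have "?A x = norm (?A x) *\<^sub>R ?e x"
      by (simp add: orbit_vector_eq)
    then show "smul (u x) (?A x) = smul (u x * of_real (norm (?A x))) (?e x)"
      by (metis scale_scale scale_of_real)
  qed simp
  finally have y: "y = (\<Sum>x\<in>E. smul (u x * of_real (norm (?A x))) (?e x))" .
  have "ip y (?e x) = u x * of_real (norm (?A x))" if "x \<in> E" for x
    by (subst y) (rule ip_orbit_sum[OF that])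
  then have "(\<Sum>x\<in>E. smul (ip y (?e x)) (?e x))
      = (\<Sum>x\<in>E. smul (u x * of_real (norm (?A x))) (?e x))"
    by (intro sum.cong) simp_all
  with y show ?thesis by (rule trans[OF _ sym])
qed

section \<open>The change of coordinates\<close>

definition orbit_coordinates :: "(int \<Rightarrow> 'a) \<Rightarrow> 'a \<Rightarrow> int \<Rightarrow> 'k" where
  "orbit_coordinates y = (\<lambda>x\<in>E. \<lambda>n. ip (y n) (orbit_vector S x n))"

definition orbit_synthesis :: "('a \<Rightarrow> int \<Rightarrow> 'k) \<Rightarrow> int \<Rightarrow> 'a" where
  "orbit_synthesis f = (\<lambda>n. \<Sum>x\<in>E. smul (f x n) (orbit_vector S x n))"

lemma orbit_synthesis_coordinates: "orbit_synthesis (orbit_coordinates y) = y"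
proof
  fix n
  have "y n = (\<Sum>x\<in>E. smul (ip (y n) (orbit_vector S x n)) (orbit_vector S x n))"
    by (rule orbit_expansion)
  then show "orbit_synthesis (orbit_coordinates y) n = y n"
    by (simp add: orbit_synthesis_def orbit_coordinates_def)
qed

lemma orbit_coordinates_synthesis:
  assumes "f \<in> extensional E"
  shows "orbit_coordinates (orbit_synthesis f) = f"
proof (rule extensionalityI[OF _ assms])
  show "orbit_coordinates (orbit_synthesis f) \<in> extensional E"
    by (simp add: orbit_coordinates_def)
  fix x assume x: "x \<in> E"
  show "orbit_coordinates (orbit_synthesis f) x = f x"
    using x by (simp add: orbit_coordinates_def orbit_synthesis_def ip_orbit_sum)
qed

text \<open>Each \<open>S (n + 1)\<close> only rescales the orbit vectors while moving them from time \<open>n + 1\<close> to time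
  \<open>n\<close>, so in the coordinates the shift is diagonal over \<open>E\<close>.\<close>

lemma shift_orbit_synthesis:
  "shift_operator S (orbit_synthesis f) = orbit_synthesis
     (product_operator E (\<lambda>x. weighted_backward_shift (\<lambda>n. of_real (orbit_weight S x n))) f)"
proof
  fix n
  interpret A: Vector_Spaces.linear smul smul "S (n + 1)" by (rule linear_S)
  have "shift_operator S (orbit_synthesis f) n
      = (\<Sum>x\<in>E. smul (f x (n + 1)) (S (n + 1) (orbit_vector S x (n + 1))))"
    by (simp add: shift_operator_def orbit_synthesis_def A.sum A.scale)
  also have "\<dots> = (\<Sum>x\<in>E. smul (of_real (orbit_weight S x (n + 1)) * f x (n + 1))
      (orbit_vector S x n))"
    using basis_nonzero[OF basis]
    by (intro sum.cong) (simp_all add: orbit_vector_step mult.commute)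
  finally show "shift_operator S (orbit_synthesis f) n = orbit_synthesis
     (product_operator E (\<lambda>x. weighted_backward_shift (\<lambda>n. of_real (orbit_weight S x n))) f) n"
    by (simp add: orbit_synthesis_def product_operator_def weighted_backward_shift_def)
qed

lemma bounded_orbit_coordinates:
  assumes "p > 0"
  shows "bounded_linear_between (lp_space p smul) (power_space E (lp_space p (*))) orbit_coordinates"
proof -
  have le: "norm (ip (y n) (orbit_vector S x n)) \<le> 1 * norm (y n)" if "x \<in> E" for x y n
    using norm_ip_unit_le[OF norm_orbit_vector_basis[OF that]] by simp
  have mem: "lp_summable p (\<lambda>n. ip (y n) (orbit_vector S x n))"
    and bound: "lp_norm p (\<lambda>n. ip (y n) (orbit_vector S x n)) \<le> lp_norm p y"
    if "x \<in> E" "lp_summable p y" for x y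
    using lp_dominated_single[of p 1 y "\<lambda>n. ip (y n) (orbit_vector S x n)"]
      assms that(2) le[OF that(1)]
    by simp_all
  have "(\<Sum>x\<in>E. lp_norm p (orbit_coordinates y x)) \<le> card E * lp_norm p y"
    if "lp_summable p y" for y
    using that by (intro sum_bounded_above) (simp add: orbit_coordinates_def bound)
  then have "\<exists>M. \<forall>y. lp_summable p y \<longrightarrow>
      (\<Sum>x\<in>E. lp_norm p (orbit_coordinates y x)) \<le> M * lp_norm p y"
    by blast
  then show ?thesis
    unfolding bounded_linear_between_def lp_space_simps power_space_simps
    by (auto simp: orbit_coordinates_def fun_eq_iff ip_add_left ip_scale_left mem)
qed

lemma bounded_orbit_synthesis:
  assumes "p > 0"
  shows "bounded_linear_between (power_space E (lp_space p (*))) (lp_space p smul) orbit_synthesis"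
proof -
  have le: "norm (orbit_synthesis f n) \<le> 1 * (\<Sum>x\<in>E. norm (f x n))" for f n
    using norm_sum_unit_le[OF norm_orbit_vector_basis] by (simp add: orbit_synthesis_def)
  have mem: "lp_summable p (orbit_synthesis f)"
    and bound: "lp_norm p (orbit_synthesis f)
      \<le> (card E * card E powr (1 / p)) * (\<Sum>x\<in>E. lp_norm p (f x))"
    if "\<And>x. x \<in> E \<Longrightarrow> lp_summable p (f x)" for f
    using lp_dominated[of E p 1 f "orbit_synthesis f"] finite_basis assms le that by simp_all
  have "\<exists>M. \<forall>f\<in>E \<rightarrow>\<^sub>E {y. lp_summable p y}.
      lp_norm p (orbit_synthesis f) \<le> M * (\<Sum>x\<in>E. lp_norm p (f x))"
    using bound by (intro exI[of _ "card E * card E powr (1 / p)"] ballI) (auto simp: PiE_iff)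
  moreover have "lp_summable p (orbit_synthesis f)"
    if "f \<in> E \<rightarrow>\<^sub>E {y. lp_summable p y}" for f
    using that by (intro mem) (auto simp: PiE_iff)
  moreover have "orbit_synthesis (\<lambda>x\<in>E. \<lambda>n. f x n + g x n)
      = (\<lambda>n. orbit_synthesis f n + orbit_synthesis g n)" for f g
    by (simp add: orbit_synthesis_def scale_left_distrib sum.distrib)
  moreover have "orbit_synthesis (\<lambda>x\<in>E. \<lambda>n. c * f x n)
      = (\<lambda>n. smul c (orbit_synthesis f n))" for c f
    by (simp add: orbit_synthesis_def scale_sum_right)
  ultimately show ?thesis
    unfolding bounded_linear_between_def lp_space_simps power_space_simps by simp
qed

lemma bounded_shift_operator:
  assumes p: "p > 0" and C: "\<And>n. onorm (S n) \<le> C"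
  shows "bounded_linear_between (lp_space p smul) (lp_space p smul) (shift_operator S)"
proof -
  have bl: "bounded_linear (S n)" for n
    using linear_imp_bounded_linear[OF linear_S finite_basis norm_orbit_vector_basis orbit_expansion] .
  have C0: "C \<ge> 0" using onorm_pos_le[OF bl] C order_trans by blast
  have le: "norm (shift_operator S y n) \<le> C * norm (y (n + 1))" for y n
    unfolding shift_operator_def
    using onorm[OF bl] mult_right_mono[OF C norm_ge_zero] order_trans by blast
  have mem: "lp_summable p (shift_operator S y)"
    and bound: "lp_norm p (shift_operator S y) \<le> C * lp_norm p y"
    if "lp_summable p y" for y
    using lp_dominated_single[of p C "\<lambda>n. y (n + 1)" "shift_operator S y"] p C0 le that
    by (simp_all add: lp_translate)
  have "\<exists>M. \<forall>y. lp_summable p y \<longrightarrow> lp_norm p (shift_operator S y) \<le> M * lp_norm p y"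
    using bound by blast
  moreover have "S n (x + y) = S n x + S n y" "S n (smul c x) = smul c (S n x)" for n c x y
    using linear_S[of n] by (simp_all add: Vector_Spaces.linear_iff)
  ultimately show ?thesis
    unfolding bounded_linear_between_def lp_space_simps
    by (simp add: mem) (simp add: shift_operator_def)
qed

end

theorem theorem2p8:
  fixes smul :: "'k::rc_field \<Rightarrow> 'a::banach \<Rightarrow> 'a"
    and ip :: "'a \<Rightarrow> 'a \<Rightarrow> 'k"
    and S :: "int \<Rightarrow> 'a \<Rightarrow> 'a"
    and E :: "'a set"
    and C p :: real
  assumes "finite_dim_hilbert_space smul ip"
    and "\<And>n. Vector_Spaces.linear smul smul (S n)"
    and "\<And>n. bij (S n)"
    and "C > 0"
    and "\<And>n. onorm (S n) < C"
    and "\<And>n. onorm (inv (S n)) < C"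
    and "hilbert_space.has_orthogonal_basis smul ip S E"
    and "1 \<le> p"
  shows "conjugate_operators
           (lp_space p smul)
           (shift_operator S)
           (power_space E (lp_space p ((*) :: 'k \<Rightarrow> 'k \<Rightarrow> 'k)))
           (product_operator E
              (\<lambda>x. weighted_backward_shift (\<lambda>n. of_real (orbit_weight S x n))))"
proof -
  interpret finite_dim_hilbert_space smul ip by (rule assms(1))
  obtain B where "finite B" "span B = UNIV" using finite_dim by blast
  moreover have "independent E" using assms(7) by (simp add: has_orthogonal_basis_def)
  ultimately have fin: "finite E" using independent_span_bound[of B E] by simp
  interpret orthogonal_system smul ip S E
    by (intro orthogonal_system.intro invertible_system.intro invertible_system_axioms.intro
        orthogonal_system_axioms.intro hilbert_space_axioms assms(2,3,7) fin)
  have p: "p > 0" using assms(8) by simp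
  show ?thesis
  proof (rule conjugate_operatorsI)
    show "bounded_linear_between (lp_space p smul) (lp_space p smul) (shift_operator S)"
      using assms(5) by (intro bounded_shift_operator[OF p]) (rule less_imp_le)
    show "bounded_linear_between (lp_space p smul) (power_space E (lp_space p (*)))
        orbit_coordinates"
      by (rule bounded_orbit_coordinates[OF p])
    show "bounded_linear_between (power_space E (lp_space p (*))) (lp_space p smul)
        orbit_synthesis"
      by (rule bounded_orbit_synthesis[OF p])
    show "orbit_synthesis (orbit_coordinates y) = y" for y
      by (rule orbit_synthesis_coordinates)
    show "orbit_coordinates (orbit_synthesis f) = f"
      if "f \<in> nvecs (power_space E (lp_space p (*)))" for f
      using that by (intro orbit_coordinates_synthesis) (simp add: power_space_simps PiE_def)
    show "product_operator E (\<lambda>x. weighted_backward_shift (\<lambda>n. of_real (orbit_weight S x n))) f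
        = orbit_coordinates (shift_operator S (orbit_synthesis f))" for f
      unfolding shift_orbit_synthesis
      by (rule orbit_coordinates_synthesis[symmetric]) (simp add: product_operator_def)
    show "nnorm (lp_space p smul) y \<ge> 0" for y
      by (simp add: lp_space_simps lp_norm_nonneg)
    show "nadd (power_space E (lp_space p (*))) f g \<in> nvecs (power_space E (lp_space p (*)))"
      if "f \<in> nvecs (power_space E (lp_space p (*)))" "g \<in> nvecs (power_space E (lp_space p (*)))"
      for f g :: "'a \<Rightarrow> int \<Rightarrow> 'k"
      using that by (auto simp: power_space_simps lp_space_simps lp_summable_add[OF p] PiE_iff)
    show "nscale (power_space E (lp_space p (*))) c f \<in> nvecs (power_space E (lp_space p (*)))"
      if "f \<in> nvecs (power_space E (lp_space p (*)))" for c and f :: "'a \<Rightarrow> int \<Rightarrow> 'k"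
      using that
      by (auto simp: power_space_simps lp_space_simps PiE_iff)
         (rule lp_dominated_single(1)[OF p norm_ge_zero[of c]], auto simp: norm_mult)
  qed
qed

end
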